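(* Let $(G,c)$ be an infinite resistance network with vertex set $G^0$. Then $(G,R^W)$ may be isometrically embedded in a Hilbert space, in the sense that there exist a Hilbert space $\mathcal{H}$ and a map $w:G^0\to\mathcal{H}$, $x\mapsto w_x$, such that $R^W(x,y)^{1/2}=\|w_x-w_y\|_{\mathcal{H}}$ for all vertices $x,y$.
   Context: A resistance network $(G,c)$ is a connected graph with vertex set $G^0$ and a conductance function $c:G^0\times G^0\to[0,\infty)$ with $c_{xy}=c_{yx}$, $c_{xx}=0$, where $x\sim y$ iff $c_{xy}>0$, and $c(x):=\sum_{y\sim x}c_{xy}<\infty$ for every vertex $x$ (vertices of infinite degree are allowed). Connected means that any two vertices are joined by a finite path of edges. The Laplacian is $(\Delta v)(x)=\sum_{y\sim x}c_{xy}(v(x)-v(y))$. On a finite network $H$, the effective resistance is $R_H(x,y)=v(x)-v(y)$, where $v$ is any solution of $\Delta v=\delta_x-\delta_y$ on $H$ ($\delta_x$ is the indicator function of $\{x\}$). An exhaustion $\{G_k\}$ of $G$ is an increasing sequence of finite connected full subgraphs with union $G$ (full: containing all edges of $G$ between its vertices, with the same conductances). $G_k^W$ is the network with vertex set $G_k^0\cup\{\infty_k\}$, all edges of $G_k$ with the same conductances, and for each $x\in G_k^0$ with a neighbour outside $G_k$ an edge from $x$ to $\infty_k$ of conductance $\sum_{y\sim x,\,y\notin G_k}c_{xy}$. The wired resistance is $R^W(x,y):=\lim_{k\to\infty}R_{G_k^W}(x,y)$ for any exhaustion with $x,y\in G_k$ for all $k$ (the limit does not depend on the exhaustion). *)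

theory Defs
  imports "HOL-Analysis.Analysis" "HOL-Algebra.Module"
begin

section \<open>Resistance networks\<close>

text \<open>A network is given by a vertex set and a conductance function on the ambient type. Two
  vertices are adjacent iff their conductance is positive. Values of the conductance function
  outside the vertex set are never used.\<close>

definition neighbours :: "'a set \<Rightarrow> ('a \<Rightarrow> 'a \<Rightarrow> real) \<Rightarrow> 'a \<Rightarrow> 'a set" where
  "neighbours V c x = {y \<in> V. c x y > 0}"

definition connected_network :: "'a set \<Rightarrow> ('a \<Rightarrow> 'a \<Rightarrow> real) \<Rightarrow> bool" where
  "connected_network V c \<longleftrightarrow>
     (\<forall>x\<in>V. \<forall>y\<in>V. (x, y) \<in> {(u, v). u \<in> V \<and> v \<in> neighbours V c u}\<^sup>*)"

locale resistance_network =
  fixes V :: "'a set" and c :: "'a \<Rightarrow> 'a \<Rightarrow> real"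
  assumes conductance_nonneg: "\<And>x y. x \<in> V \<Longrightarrow> y \<in> V \<Longrightarrow> 0 \<le> c x y"
    and conductance_sym: "\<And>x y. x \<in> V \<Longrightarrow> y \<in> V \<Longrightarrow> c x y = c y x"
    and conductance_irrefl: "\<And>x. x \<in> V \<Longrightarrow> c x x = 0"
    and total_conductance_finite: "\<And>x. x \<in> V \<Longrightarrow> (\<lambda>y. c x y) summable_on neighbours V c x"
    and connected: "connected_network V c"

definition laplacian :: "'a set \<Rightarrow> ('a \<Rightarrow> 'a \<Rightarrow> real) \<Rightarrow> ('a \<Rightarrow> real) \<Rightarrow> 'a \<Rightarrow> real" where
  "laplacian V c v x = (\<Sum>\<^sub>\<infinity>y\<in>neighbours V c x. c x y * (v x - v y))"

text \<open>Only meant for finite connected networks, where a solution \<open>v\<close> exists and is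
  unique up to an additive constant.\<close>

definition effective_resistance :: "'a set \<Rightarrow> ('a \<Rightarrow> 'a \<Rightarrow> real) \<Rightarrow> 'a \<Rightarrow> 'a \<Rightarrow> real" where
  "effective_resistance V c x y =
     (THE r. \<exists>v. (\<forall>z\<in>V. laplacian V c v z = indicator {x} z - indicator {y} z) \<and> r = v x - v y)"

text \<open>A full subgraph is determined by its vertex set, so an exhaustion is a sequence of vertex
  sets. As the subgraphs are full and increasing, their union also contains every edge.\<close>

definition exhaustion :: "'a set \<Rightarrow> ('a \<Rightarrow> 'a \<Rightarrow> real) \<Rightarrow> (nat \<Rightarrow> 'a set) \<Rightarrow> bool" where
  "exhaustion V c F \<longleftrightarrow>
     incseq F \<and> (\<forall>k. finite (F k) \<and> connected_network (F k) c) \<and> (\<Union>k. F k) = V"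

text \<open>The wired network of a full subgraph \<open>F\<close>: \<open>None\<close> is the vertex at
  infinity. A vertex of \<open>F\<close> without neighbours outside \<open>F\<close> gets conductance 0 to
  \<open>None\<close>, that is, no edge.\<close>

definition wired_vertices :: "'a set \<Rightarrow> 'a option set" where
  "wired_vertices F = insert None (Some ` F)"

fun wired_conductance ::
  "'a set \<Rightarrow> ('a \<Rightarrow> 'a \<Rightarrow> real) \<Rightarrow> 'a set \<Rightarrow> 'a option \<Rightarrow> 'a option \<Rightarrow> real" where
  "wired_conductance V c F (Some x) (Some y) = c x y"
| "wired_conductance V c F (Some x) None = (\<Sum>\<^sub>\<infinity>y\<in>neighbours V c x - F. c x y)"
| "wired_conductance V c F None (Some x) = (\<Sum>\<^sub>\<infinity>y\<in>neighbours V c x - F. c x y)"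
| "wired_conductance V c F None None = 0"

text \<open>The limit along every exhaustion containing \<open>x\<close> and \<open>y\<close> from the start;
  it exists and does not depend on the exhaustion.\<close>

definition wired_resistance :: "'a set \<Rightarrow> ('a \<Rightarrow> 'a \<Rightarrow> real) \<Rightarrow> 'a \<Rightarrow> 'a \<Rightarrow> real" where
  "wired_resistance V c x y =
     (THE r. \<forall>F. exhaustion V c F \<and> (\<forall>k. x \<in> F k \<and> y \<in> F k) \<longrightarrow>
        (\<lambda>k. effective_resistance (wired_vertices (F k)) (wired_conductance V c (F k))
                (Some x) (Some y)) \<longlonglongrightarrow> r)"


section \<open>Hilbert spaces with explicit carrier\<close>

text \<open>The class of complete real inner product spaces lives on types, which cannot be
  existentially quantified; hence a Hilbert space is a real vector space with a carrier set, together
  with an inner product. The fields \<open>mult\<close> and \<open>one\<close> inherited from the ring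
  record are irrelevant for a module.\<close>

definition real_ring :: "real ring" where
  "real_ring = \<lparr>carrier = UNIV, mult = (*), one = 1, zero = 0, add = (+)\<rparr>"

record 'h inner_product_space = "(real, 'h) module" +
  inner_prod :: "'h \<Rightarrow> 'h \<Rightarrow> real"

definition hnorm :: "'h inner_product_space \<Rightarrow> 'h \<Rightarrow> real" where
  "hnorm H u = sqrt (inner_prod H u u)"

locale real_hilbert_space = Module.module real_ring H
  for H :: "'h inner_product_space" (structure) +
  assumes inner_prod_sym:
      "\<And>u v. u \<in> carrier H \<Longrightarrow> v \<in> carrier H \<Longrightarrow> inner_prod H u v = inner_prod H v u"
    and inner_prod_add_left:
      "\<And>u v w. u \<in> carrier H \<Longrightarrow> v \<in> carrier H \<Longrightarrow> w \<in> carrier H \<Longrightarrow>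
         inner_prod H (u \<oplus>\<^bsub>H\<^esub> v) w = inner_prod H u w + inner_prod H v w"
    and inner_prod_smult_left:
      "\<And>a u v. u \<in> carrier H \<Longrightarrow> v \<in> carrier H \<Longrightarrow>
         inner_prod H (a \<odot>\<^bsub>H\<^esub> u) v = a * inner_prod H u v"
    and inner_prod_nonneg: "\<And>u. u \<in> carrier H \<Longrightarrow> 0 \<le> inner_prod H u u"
    and inner_prod_definite: "\<And>u. u \<in> carrier H \<Longrightarrow> inner_prod H u u = 0 \<Longrightarrow> u = \<zero>\<^bsub>H\<^esub>"
    and complete:
      "\<And>s :: nat \<Rightarrow> 'h. range s \<subseteq> carrier H \<Longrightarrow>
         (\<And>e. e > 0 \<Longrightarrow> \<exists>N. \<forall>m\<ge>N. \<forall>n\<ge>N. hnorm H (s m \<ominus>\<^bsub>H\<^esub> s n) < e) \<Longrightarrow>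
         \<exists>u\<in>carrier H. (\<lambda>n. hnorm H (s n \<ominus>\<^bsub>H\<^esub> u)) \<longlonglongrightarrow> 0"

end

theory Submission
  imports Defs
begin

text \<open>Wiring the complement of a finite vertex set \<open>F\<close> into one vertex and giving that vertex
  potential 0 turns functions on the wired network into functions on \<open>V\<close> that vanish outside
  \<open>F\<close>, with the same energy. All wired networks therefore share one quadratic form, the Dirichlet
  energy on finitely supported functions. It is positive definite because the network is connected
  and infinite: a function of energy 0 is constant, and it vanishes somewhere. Hence its matrix
  on \<open>F\<close> has an inverse, the Green kernel \<open>G\<close>, and the resistance between \<open>x\<close> and \<open>y\<close> in the
  wired network of \<open>F\<close> is \<open>G x x + G y y - 2 * G x y\<close> (\<open>effective_resistance_wired\<close>).

  Adding one vertex to \<open>F\<close> changes the Green kernel by a rank one term \<open>e x * e y\<close>; this is a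
  Gram-Schmidt step, \<open>e\<close> being the normalised component of the indicator of the new vertex that is
  energy-orthogonal to the functions supported on the old ones (\<open>is_green_kernel_insert\<close>). So the
  resistance grows by \<open>(e x - e y)\<^sup>2\<close>. Two consequences follow. Resistances are monotone in
  \<open>F\<close>, and they are bounded, since the energy controls potential differences along a path
  (\<open>path_bound\<close>); so they converge, to the same value along every exhaustion. And along an
  enumeration of \<open>V\<close>, with \<open>e k\<close> the function produced by the \<open>k\<close>-th vertex, the limit is
  \<open>\<Sum>k. (e k x - e k y)\<^sup>2\<close> (\<open>wired_resistance_sums\<close>), a squared distance in the space of
  square summable sequences. Indexing the sequences by the vertices instead of by numbers makes that
  Hilbert space a set of functions on \<open>V\<close>.\<close>

section \<open>The Hilbert space of square summable functions on a set\<close>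

definition l2_space :: "'a set \<Rightarrow> ('a \<Rightarrow> real) inner_product_space" where
  "l2_space S =
     \<lparr>carrier = {f. (\<forall>x. x \<notin> S \<longrightarrow> f x = 0) \<and> (\<lambda>x. (f x)\<^sup>2) summable_on S},
      mult = (\<lambda>f g x. f x * g x), one = (\<lambda>x. 1), zero = (\<lambda>x. 0),
      add = (\<lambda>f g x. f x + g x), smult = (\<lambda>a f x. a * f x),
      inner_prod = (\<lambda>f g. \<Sum>\<^sub>\<infinity>x\<in>S. f x * g x)\<rparr>"

lemma mem_l2_space:
  "f \<in> carrier (l2_space S) \<longleftrightarrow> (\<forall>x. x \<notin> S \<longrightarrow> f x = 0) \<and> (\<lambda>x. (f x)\<^sup>2) summable_on S"
  by (simp add: l2_space_def)

lemma l2_space_simps [simp]: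
  "\<zero>\<^bsub>l2_space S\<^esub> = (\<lambda>x. 0)"
  "f \<oplus>\<^bsub>l2_space S\<^esub> g = (\<lambda>x. f x + g x)"
  "a \<odot>\<^bsub>l2_space S\<^esub> f = (\<lambda>x. a * f x)"
  "inner_prod (l2_space S) f g = (\<Sum>\<^sub>\<infinity>x\<in>S. f x * g x)"
  by (simp_all add: l2_space_def)

lemma hnorm_l2_space: "hnorm (l2_space S) f = sqrt (\<Sum>\<^sub>\<infinity>x\<in>S. (f x)\<^sup>2)"
  by (simp add: hnorm_def power2_eq_square)

lemma l2_space_summable_mult:
  assumes "f \<in> carrier (l2_space S)" "g \<in> carrier (l2_space S)"
  shows "(\<lambda>x. f x * g x) summable_on S"
proof -
  have "(\<lambda>x. (f x)\<^sup>2 + (g x)\<^sup>2) summable_on S"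
    using assms by (auto simp: mem_l2_space intro: summable_on_add)
  moreover have "norm (f x * g x) \<le> (f x)\<^sup>2 + (g x)\<^sup>2" for x
  proof -
    have "0 \<le> (\<bar>f x\<bar> - \<bar>g x\<bar>)\<^sup>2" by simp
    then have "2 * (\<bar>f x\<bar> * \<bar>g x\<bar>) \<le> (f x)\<^sup>2 + (g x)\<^sup>2"
      by (simp add: power2_diff)
    moreover have "0 \<le> \<bar>f x\<bar> * \<bar>g x\<bar>" by simp
    ultimately show ?thesis unfolding real_norm_def abs_mult by linarith
  qed
  ultimately have "(\<lambda>x. norm (f x * g x)) summable_on S"
    by (rule Infinite_Sum.abs_summable_on_comparison_test')
  then show ?thesis by (rule abs_summable_summable)
qed

lemma l2_space_add:
  assumes "f \<in> carrier (l2_space S)" "g \<in> carrier (l2_space S)"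
  shows "(\<lambda>x. f x + g x) \<in> carrier (l2_space S)"
proof -
  have "(\<lambda>x. ((f x)\<^sup>2 + (g x)\<^sup>2) + 2 * (f x * g x)) summable_on S"
    using assms l2_space_summable_mult[OF assms]
    by (auto simp: mem_l2_space intro!: summable_on_add summable_on_cmult_right)
  then show ?thesis using assms by (simp add: mem_l2_space power2_sum mult.assoc)
qed

lemma l2_space_smult:
  assumes "f \<in> carrier (l2_space S)"
  shows "(\<lambda>x. a * f x) \<in> carrier (l2_space S)"
  using assms by (auto simp: mem_l2_space power_mult_distrib intro: summable_on_cmult_right)

lemma l2_space_uminus: "f \<in> carrier (l2_space S) \<Longrightarrow> (\<lambda>x. - f x) \<in> carrier (l2_space S)"
  by (simp add: mem_l2_space)

lemma abelian_group_l2_space: "abelian_group (l2_space S)"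
proof (rule abelian_groupI)
  fix f assume "f \<in> carrier (l2_space S)"
  then show "\<exists>g\<in>carrier (l2_space S). g \<oplus>\<^bsub>l2_space S\<^esub> f = \<zero>\<^bsub>l2_space S\<^esub>"
    by (intro bexI[of _ "\<lambda>x. - f x"]) (auto intro: l2_space_uminus)
next
  fix f g assume "f \<in> carrier (l2_space S)" "g \<in> carrier (l2_space S)"
  then show "f \<oplus>\<^bsub>l2_space S\<^esub> g \<in> carrier (l2_space S)"
    by (simp add: l2_space_add)
qed (simp_all add: mem_l2_space add_ac)

lemma l2_space_minus:
  assumes "f \<in> carrier (l2_space S)" "g \<in> carrier (l2_space S)"
  shows "f \<ominus>\<^bsub>l2_space S\<^esub> g = (\<lambda>x. f x - g x)"
proof -
  interpret abelian_group "l2_space S" by (rule abelian_group_l2_space)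
  have "\<ominus>\<^bsub>l2_space S\<^esub> g = (\<lambda>x. - g x)"
    using assms by (intro minus_equality) (auto intro: l2_space_uminus)
  then show ?thesis by (simp add: a_minus_def)
qed

lemma l2_space_diff:
  assumes "f \<in> carrier (l2_space S)" "g \<in> carrier (l2_space S)"
  shows "(\<lambda>x. f x - g x) \<in> carrier (l2_space S)"
  using l2_space_add[OF assms(1) l2_space_uminus[OF assms(2)]] by simp

lemma cring_real_ring: "cring real_ring"
proof (rule cringI)
  show "abelian_group real_ring"
    by (rule abelian_groupI)
       (auto simp: real_ring_def algebra_simps intro: exI[of _ "- x" for x])
  show "Group.comm_monoid real_ring"
    by (rule comm_monoidI) (auto simp: real_ring_def)
qed (auto simp: real_ring_def algebra_simps)

lemma module_l2_space: "Module.module real_ring (l2_space S)"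
proof (rule moduleI)
  show "cring real_ring" by (rule cring_real_ring)
  show "abelian_group (l2_space S)" by (rule abelian_group_l2_space)
qed (auto intro: l2_space_smult simp: real_ring_def algebra_simps)

text \<open>This and the next lemma trade infinite sums for bounds over finite index sets. That is the form in
  which bounds survive pointwise limits, which completeness requires.\<close>

lemma sum_power2_le_hnorm:
  assumes "f \<in> carrier (l2_space S)" "finite T" "T \<subseteq> S"
  shows "(\<Sum>x\<in>T. (f x)\<^sup>2) \<le> (hnorm (l2_space S) f)\<^sup>2"
proof -
  have "(\<Sum>x\<in>T. (f x)\<^sup>2) \<le> (\<Sum>\<^sub>\<infinity>x\<in>S. (f x)\<^sup>2)"
    using assms by (intro finite_sum_le_infsum) (auto simp: mem_l2_space)
  then show ?thesis
    by (simp add: hnorm_l2_space infsum_nonneg)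
qed

lemma hnorm_l2_space_le:
  assumes "\<And>x. x \<notin> S \<Longrightarrow> f x = 0" "0 \<le> b"
    and "\<And>T. finite T \<Longrightarrow> T \<subseteq> S \<Longrightarrow> (\<Sum>x\<in>T. (f x)\<^sup>2) \<le> b\<^sup>2"
  shows "f \<in> carrier (l2_space S)" "hnorm (l2_space S) f \<le> b"
proof -
  have "(\<lambda>x. (f x)\<^sup>2) summable_on S"
    by (rule nonneg_bdd_above_summable_on) (auto intro!: bdd_aboveI assms(3))
  then show "f \<in> carrier (l2_space S)" using assms(1) by (simp add: mem_l2_space)
  have "(\<Sum>\<^sub>\<infinity>x\<in>S. (f x)\<^sup>2) \<le> b\<^sup>2"
    by (rule infsum_le_finite_sums) (use \<open>_ summable_on S\<close> assms(3) in auto)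
  then show "hnorm (l2_space S) f \<le> b"
    unfolding hnorm_l2_space using assms(2) by (rule real_le_lsqrt[rotated])
qed

text \<open>A Cauchy sequence converges pointwise; letting one index of the Cauchy condition tend to infinity
  in each finite partial sum bounds the distance to the pointwise limit.\<close>

lemma l2_space_complete:
  fixes s :: "nat \<Rightarrow> 'a \<Rightarrow> real"
  assumes s: "\<And>n. s n \<in> carrier (l2_space S)"
    and cauchy: "\<And>e. e > 0 \<Longrightarrow>
      \<exists>N. \<forall>m\<ge>N. \<forall>n\<ge>N. hnorm (l2_space S) (\<lambda>x. s m x - s n x) < e"
  shows "\<exists>u\<in>carrier (l2_space S). (\<lambda>n. hnorm (l2_space S) (\<lambda>x. s n x - u x)) \<longlonglongrightarrow> 0"
proof -
  have point: "\<bar>s m x - s n x\<bar> \<le> hnorm (l2_space S) (\<lambda>x. s m x - s n x)" for m n x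
  proof (cases "x \<in> S")
    case True
    then have "(s m x - s n x)\<^sup>2 \<le> (hnorm (l2_space S) (\<lambda>x. s m x - s n x))\<^sup>2"
      using sum_power2_le_hnorm[OF l2_space_diff[OF s s], of "{x}" m n] by simp
    then show ?thesis
      by (rule abs_le_square_iff[THEN iffD2, THEN order_trans])
         (simp add: hnorm_l2_space infsum_nonneg)
  next
    case False
    then show ?thesis using s by (simp add: mem_l2_space hnorm_l2_space infsum_nonneg)
  qed
  have "Cauchy (\<lambda>n. s n x)" for x
    unfolding Cauchy_def dist_real_def
    using cauchy order.strict_trans1[OF point] by meson
  then have "\<exists>l. (\<lambda>n. s n x) \<longlonglongrightarrow> l" for x
    using Cauchy_convergent convergent_def by blast
  then obtain u where u: "\<And>x. (\<lambda>n. s n x) \<longlonglongrightarrow> u x" by metis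
  have u0: "u x = 0" if "x \<notin> S" for x
    using u[of x] s that by (simp add: mem_l2_space LIMSEQ_const_iff)
  have tail: "\<exists>N. \<forall>n\<ge>N. (\<lambda>x. s n x - u x) \<in> carrier (l2_space S) \<and>
      hnorm (l2_space S) (\<lambda>x. s n x - u x) \<le> e" if "e > 0" for e
  proof -
    obtain N where N: "\<And>m n. m \<ge> N \<Longrightarrow> n \<ge> N \<Longrightarrow>
        hnorm (l2_space S) (\<lambda>x. s m x - s n x) < e"
      using cauchy[OF \<open>e > 0\<close>] by blast
    have "(\<Sum>x\<in>T. (s n x - u x)\<^sup>2) \<le> e\<^sup>2" if n: "n \<ge> N" and T: "finite T" "T \<subseteq> S" for n T
    proof (rule LIMSEQ_le_const2)
      show "(\<lambda>m. \<Sum>x\<in>T. (s n x - s m x)\<^sup>2) \<longlonglongrightarrow> (\<Sum>x\<in>T. (s n x - u x)\<^sup>2)"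
        by (intro tendsto_intros u)
      have "(\<Sum>x\<in>T. (s n x - s m x)\<^sup>2) \<le> e\<^sup>2" if "m \<ge> N" for m
      proof -
        have "(\<Sum>x\<in>T. (s n x - s m x)\<^sup>2) \<le> (hnorm (l2_space S) (\<lambda>x. s n x - s m x))\<^sup>2"
          by (rule sum_power2_le_hnorm[OF l2_space_diff[OF s s] T])
        also have "\<dots> \<le> e\<^sup>2"
          using N[OF n that] by (intro power_mono) (auto simp: hnorm_l2_space infsum_nonneg)
        finally show ?thesis .
      qed
      then show "\<exists>N. \<forall>m\<ge>N. (\<Sum>x\<in>T. (s n x - s m x)\<^sup>2) \<le> e\<^sup>2" by blast
    qed
    moreover have "s n x - u x = 0" if "x \<notin> S" for n x
      using s u0 that by (simp add: mem_l2_space)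
    ultimately show ?thesis
      using \<open>e > 0\<close> by (intro exI[of _ N] allI impI conjI hnorm_l2_space_le[where b = e]) auto
  qed
  obtain N where "(\<lambda>x. s N x - u x) \<in> carrier (l2_space S)"
    using tail[of 1] by auto
  from l2_space_diff[OF s[of N] this] have "u \<in> carrier (l2_space S)" by simp
  moreover have "(\<lambda>n. hnorm (l2_space S) (\<lambda>x. s n x - u x)) \<longlonglongrightarrow> 0"
  proof (rule LIMSEQ_I)
    fix r :: real assume "0 < r"
    then obtain N where "\<forall>n\<ge>N. hnorm (l2_space S) (\<lambda>x. s n x - u x) \<le> r / 2"
      using tail[of "r/2"] by auto
    moreover have "0 \<le> hnorm (l2_space S) f" for f
      by (simp add: hnorm_l2_space infsum_nonneg)
    ultimately show "\<exists>N. \<forall>n\<ge>N. norm (hnorm (l2_space S) (\<lambda>x. s n x - u x) - 0) < r"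
      using \<open>0 < r\<close> by (intro exI[of _ N]) (smt (verit) field_sum_of_halves real_norm_def)
  qed
  ultimately show ?thesis by blast
qed

theorem real_hilbert_space_l2_space: "real_hilbert_space (l2_space S)"
proof -
  have nonneg: "0 \<le> inner_prod (l2_space S) u u" for u
    by (simp add: infsum_nonneg)
  show ?thesis
  proof (intro real_hilbert_space.intro module_l2_space real_hilbert_space_axioms.intro nonneg)
    fix u v w assume uvw: "u \<in> carrier (l2_space S)" "v \<in> carrier (l2_space S)"
      "w \<in> carrier (l2_space S)"
    show "inner_prod (l2_space S) (u \<oplus>\<^bsub>l2_space S\<^esub> v) w
        = inner_prod (l2_space S) u w + inner_prod (l2_space S) v w"
      using uvw by (simp add: distrib_right infsum_add l2_space_summable_mult)
  next
    fix u assume u: "u \<in> carrier (l2_space S)" "inner_prod (l2_space S) u u = 0"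
    show "u = \<zero>\<^bsub>l2_space S\<^esub>"
    proof
      fix x
      show "u x = \<zero>\<^bsub>l2_space S\<^esub> x"
        using nonneg_infsum_le_0D[of "\<lambda>x. u x * u x" S x] u l2_space_summable_mult[OF u(1) u(1)]
        by (cases "x \<in> S") (auto simp: mem_l2_space)
    qed
  next
    fix s :: "nat \<Rightarrow> 'a \<Rightarrow> real"
    assume s: "range s \<subseteq> carrier (l2_space S)"
      and c: "\<And>e. e > 0 \<Longrightarrow>
        \<exists>N. \<forall>m\<ge>N. \<forall>n\<ge>N. hnorm (l2_space S) (s m \<ominus>\<^bsub>l2_space S\<^esub> s n) < e"
    have s': "s n \<in> carrier (l2_space S)" for n using s by blast
    show "\<exists>u\<in>carrier (l2_space S). (\<lambda>n. hnorm (l2_space S) (s n \<ominus>\<^bsub>l2_space S\<^esub> u)) \<longlonglongrightarrow> 0"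
      using l2_space_complete[of s S, OF s'] c s' by (simp add: l2_space_minus cong: bex_cong)
  next
    fix a u v
    show "inner_prod (l2_space S) (a \<odot>\<^bsub>l2_space S\<^esub> u) v = a * inner_prod (l2_space S) u v"
      by (simp add: mult.assoc infsum_cmult_right')
  qed (simp add: mult.commute)
qed

section \<open>Green kernels of positive definite matrices\<close>

definition quadratic_form :: "('a \<Rightarrow> 'a \<Rightarrow> real) \<Rightarrow> 'a set \<Rightarrow> ('a \<Rightarrow> real) \<Rightarrow> real" where
  "quadratic_form A F u = (\<Sum>x\<in>F. u x * (\<Sum>y\<in>F. A x y * u y))"

lemma quadratic_form_mono_neutral:
  assumes "finite F'" "F \<subseteq> F'" "\<And>x. x \<in> F' - F \<Longrightarrow> u x = 0"
  shows "quadratic_form A F' u = quadratic_form A F u"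
proof -
  have "(\<Sum>y\<in>F'. A x y * u y) = (\<Sum>y\<in>F. A x y * u y)" for x
    by (rule sum.mono_neutral_right) (use assms in auto)
  then show ?thesis
    unfolding quadratic_form_def using assms by (simp add: sum.mono_neutral_right)
qed

lemma quadratic_form_cong:
  assumes "\<And>x. x \<in> F \<Longrightarrow> u x = u' x"
  shows "quadratic_form A F u = quadratic_form A F u'"
  unfolding quadratic_form_def using assms by (simp cong: sum.cong)

locale positive_definite =
  fixes V :: "'a set" and A :: "'a \<Rightarrow> 'a \<Rightarrow> real"
  assumes sym: "\<And>x y. x \<in> V \<Longrightarrow> y \<in> V \<Longrightarrow> A x y = A y x"
    and quadratic_form_pos: "\<And>F u x. finite F \<Longrightarrow> F \<subseteq> V \<Longrightarrow> x \<in> F \<Longrightarrow> u x \<noteq> 0 \<Longrightarrow>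
      0 < quadratic_form A F u"
begin

text \<open>The Green kernel is extended by 0 outside \<open>F\<close>, so that kernels for different finite sets
  can be compared as functions on the whole type.\<close>

definition is_green_kernel :: "'a set \<Rightarrow> ('a \<Rightarrow> 'a \<Rightarrow> real) \<Rightarrow> bool" where
  "is_green_kernel F G \<longleftrightarrow> (\<forall>x y. G x y = G y x) \<and> (\<forall>x y. x \<notin> F \<longrightarrow> G x y = 0) \<and>
     (\<forall>x\<in>F. \<forall>y\<in>F. (\<Sum>z\<in>F. A x z * G z y) = (if x = y then 1 else 0))"

lemma kernel_trivial:
  assumes "finite F" "F \<subseteq> V" "\<And>x. x \<in> F \<Longrightarrow> (\<Sum>y\<in>F. A x y * u y) = 0" "x \<in> F"
  shows "u x = 0"
  using quadratic_form_pos[OF assms(1,2,4), of u] assms(3) by (auto simp: quadratic_form_def)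

lemma green_kernel_unique:
  assumes "finite F" "F \<subseteq> V" "is_green_kernel F G" "is_green_kernel F G'"
  shows "G = G'"
proof (intro ext)
  fix x y
  show "G x y = G' x y"
  proof (cases "x \<in> F \<and> y \<in> F")
    case True
    have "G x y - G' x y = 0"
      by (rule kernel_trivial[OF assms(1,2), where u = "\<lambda>x. G x y - G' x y"])
         (use assms True in \<open>auto simp: is_green_kernel_def right_diff_distrib sum_subtractf\<close>)
    then show ?thesis by simp
  next
    case False
    then show ?thesis using assms(3,4) unfolding is_green_kernel_def by metis
  qed
qed

text \<open>The function \<open>h\<close> below is the indicator of the new vertex \<open>p\<close> minus its projection onto the functions
  supported on \<open>F\<close>, orthogonally for the form of \<open>A\<close>. Thus \<open>A h\<close> vanishes on \<open>F\<close>, its value \<open>s\<close> at \<open>p\<close> is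
  the value of the form at \<open>h\<close>, hence positive, and \<open>e = h / sqrt s\<close> is a unit vector. The lemma gives
  existence of Green kernels by induction as well as the rank one growth of resistances.\<close>

lemma is_green_kernel_insert:
  assumes F: "finite F" "p \<notin> F" "insert p F \<subseteq> V" and G: "is_green_kernel F G"
  shows "\<exists>e. is_green_kernel (insert p F) (\<lambda>x y. G x y + e x * e y)"
proof -
  have Gs: "G x y = G y x" and G0: "x \<notin> F \<Longrightarrow> G x y = 0" for x y
    using G by (auto simp: is_green_kernel_def)
  have G0': "y \<notin> F \<Longrightarrow> G x y = 0" for x y
    using Gs G0 by metis
  have AG: "(\<Sum>z\<in>F. A x z * G z y) = (if x = y then 1 else 0)" if "x \<in> F" "y \<in> F" for x y
    using G that by (auto simp: is_green_kernel_def)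
  define h where "h x = (if x = p then 1 else if x \<in> F then - (\<Sum>z\<in>F. G x z * A z p) else 0)" for x
  have Ah: "(\<Sum>z\<in>insert p F. A x z * h z) = 0" if x: "x \<in> F" for x
  proof -
    have "(\<Sum>z\<in>F. A x z * h z) = (\<Sum>z\<in>F. - (\<Sum>w\<in>F. A x z * G z w * A w p))"
      using F(2) by (intro sum.cong) (auto simp: h_def sum_distrib_left mult.assoc)
    also have "\<dots> = - (\<Sum>w\<in>F. \<Sum>z\<in>F. A x z * G z w * A w p)"
      unfolding sum_negf by (subst sum.swap) simp
    also have "\<dots> = - (\<Sum>w\<in>F. (\<Sum>z\<in>F. A x z * G z w) * A w p)"
      by (simp add: sum_distrib_right)
    also have "\<dots> = - (\<Sum>w\<in>F. (if w = x then A w p else 0))"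
      using x by (intro arg_cong[where f = uminus] sum.cong refl) (auto simp: AG)
    also have "\<dots> = - A x p"
      using x F(1) by simp
    finally show ?thesis using F by (simp add: h_def)
  qed
  define s where "s = (\<Sum>z\<in>insert p F. A p z * h z)"
  have "0 < quadratic_form A (insert p F) h"
    using F by (intro quadratic_form_pos[of _ p]) (auto simp: h_def)
  also have "quadratic_form A (insert p F) h = h p * s + (\<Sum>x\<in>F. h x * (\<Sum>z\<in>insert p F. A x z * h z))"
    unfolding quadratic_form_def s_def using F by (subst sum.insert) auto
  also have "\<dots> = s"
    using Ah by (simp add: h_def del: sum.insert)
  finally have s: "s > 0" .
  define e where "e x = h x / sqrt s" for x
  have ee: "e x * e y = h x * h y / s" for x y
    using s by (simp add: e_def)
  have expand: "(\<Sum>z\<in>insert p F. A x z * (G z y + e z * e y))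
      = (\<Sum>z\<in>F. A x z * G z y) + (\<Sum>z\<in>insert p F. A x z * h z) * (h y / s)" for x y
  proof -
    have "(\<Sum>z\<in>insert p F. A x z * (G z y + e z * e y))
        = (\<Sum>z\<in>insert p F. A x z * G z y) + (\<Sum>z\<in>insert p F. A x z * h z * (h y / s))"
      unfolding ee by (simp add: distrib_left sum.distrib mult.assoc del: sum.insert)
    moreover have "(\<Sum>z\<in>insert p F. A x z * G z y) = (\<Sum>z\<in>F. A x z * G z y)"
      using F by (simp add: G0)
    ultimately show ?thesis by (simp only: sum_distrib_right)
  qed
  have "is_green_kernel (insert p F) (\<lambda>x y. G x y + e x * e y)"
    unfolding is_green_kernel_def
  proof (intro conjI allI impI ballI)
    fix x y show "G x y + e x * e y = G y x + e y * e x" using Gs[of x y] by simp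
  next
    fix x y assume "x \<notin> insert p F"
    then show "G x y + e x * e y = 0" by (simp add: G0 ee h_def)
  next
    fix x y assume x: "x \<in> insert p F" and y: "y \<in> insert p F"
    show "(\<Sum>z\<in>insert p F. A x z * (G z y + e z * e y)) = (if x = y then 1 else 0)"
    proof (cases "x = p")
      case False
      then have x: "x \<in> F" using x by simp
      show ?thesis
        unfolding expand Ah[OF x] using x y False F(2) by (auto simp: AG G0')
    next
      case True
      show ?thesis
      proof (cases "y = p")
        case False
        then have y: "y \<in> F" using y by simp
        \<comment> \<open>By symmetry, the old kernel contributes \<open>- h y\<close>, which cancels the rank one term.\<close>
        have "(\<Sum>z\<in>F. A p z * G z y) = (\<Sum>z\<in>F. G y z * A z p)"
        proof (rule sum.cong)
          fix z assume "z \<in> F"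
          then have "A p z = A z p" using F(3) by (intro sym) auto
          then show "A p z * G z y = G y z * A z p" using Gs[of z y] by simp
        qed simp
        also have "\<dots> = - h y" using y False by (simp add: h_def)
        finally show ?thesis
          unfolding expand using False True s by (simp add: s_def[symmetric] del: sum.insert)
      next
        case yp: True
        have "(\<Sum>z\<in>F. A p z * G z p) = 0"
          using F(2) by (simp add: G0')
        moreover have "h p = 1" by (simp add: h_def)
        ultimately show ?thesis
          unfolding expand using yp True s by (simp add: s_def[symmetric] del: sum.insert)
      qed
    qed
  qed
  then show ?thesis by blast
qed

lemma green_kernel_exists: "finite F \<Longrightarrow> F \<subseteq> V \<Longrightarrow> \<exists>G. is_green_kernel F G"
proof (induction F rule: finite_induct)
  case empty
  have "is_green_kernel {} (\<lambda>x y. 0)" by (simp add: is_green_kernel_def)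
  then show ?case by blast
next
  case (insert p F)
  then obtain G where "is_green_kernel F G" by auto
  from is_green_kernel_insert[OF insert(1,2,4) this] show ?case by blast
qed

definition green :: "'a set \<Rightarrow> 'a \<Rightarrow> 'a \<Rightarrow> real" where
  "green F = (THE G. is_green_kernel F G)"

lemma is_green_kernel_green:
  assumes "finite F" "F \<subseteq> V"
  shows "is_green_kernel F (green F)"
proof -
  obtain G where "is_green_kernel F G" using green_kernel_exists[OF assms] by blast
  then show ?thesis
    unfolding green_def
    using theI[of "is_green_kernel F" G] green_kernel_unique[OF assms] by blast
qed

lemma green_insert:
  assumes "finite F" "p \<notin> F" "insert p F \<subseteq> V"
  shows "\<exists>e. \<forall>x y. green (insert p F) x y = green F x y + e x * e y"
proof -
  have "is_green_kernel F (green F)" using assms by (intro is_green_kernel_green) auto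
  from is_green_kernel_insert[OF assms this] obtain e where
    "is_green_kernel (insert p F) (\<lambda>x y. green F x y + e x * e y)" by blast
  then have "green (insert p F) = (\<lambda>x y. green F x y + e x * e y)"
    using assms by (intro green_kernel_unique[of "insert p F"] is_green_kernel_green) auto
  then show ?thesis by auto
qed

text \<open>The potential of a unit current from \<open>x\<close> to \<open>y\<close> when everything outside \<open>F\<close> is grounded.\<close>

definition dipole :: "'a set \<Rightarrow> 'a \<Rightarrow> 'a \<Rightarrow> 'a \<Rightarrow> real" where
  "dipole F x y z = green F z x - green F z y"

definition grounded_resistance :: "'a set \<Rightarrow> 'a \<Rightarrow> 'a \<Rightarrow> real" where
  "grounded_resistance F x y = dipole F x y x - dipole F x y y"

lemma dipole_outside:
  assumes "finite F" "F \<subseteq> V" "z \<notin> F"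
  shows "dipole F x y z = 0"
proof -
  have "green F z w = 0" for w
    using is_green_kernel_green[OF assms(1,2)] assms(3) unfolding is_green_kernel_def by blast
  then show ?thesis by (simp add: dipole_def)
qed

lemma dipole_equation:
  assumes "finite F" "F \<subseteq> V" "x \<in> F" "y \<in> F" "z \<in> F"
  shows "(\<Sum>w\<in>F. A z w * dipole F x y w) = indicator {x} z - indicator {y} z"
  using is_green_kernel_green[OF assms(1,2)] assms(3-)
  by (auto simp: dipole_def is_green_kernel_def right_diff_distrib sum_subtractf)

lemma dipole_unique:
  assumes F: "finite F" "F \<subseteq> V" "x \<in> F" "y \<in> F" "z \<in> F"
    and u: "\<And>z. z \<in> F \<Longrightarrow> (\<Sum>w\<in>F. A z w * u w) = indicator {x} z - indicator {y} z"
  shows "u z = dipole F x y z"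
proof -
  have "u z - dipole F x y z = 0"
    by (rule kernel_trivial[OF F(1,2), where u = "\<lambda>z. u z - dipole F x y z"])
       (use F u dipole_equation[OF F(1-4)] in \<open>auto simp: right_diff_distrib sum_subtractf\<close>)
  then show ?thesis by simp
qed

lemma quadratic_form_dipole:
  assumes "finite F" "F \<subseteq> V" "x \<in> F" "y \<in> F"
  shows "quadratic_form A F (dipole F x y) = grounded_resistance F x y"
proof -
  have "quadratic_form A F (dipole F x y)
      = (\<Sum>z\<in>F. dipole F x y z * (indicator {x} z - indicator {y} z))"
    unfolding quadratic_form_def using assms by (intro sum.cong) (auto simp: dipole_equation)
  then show ?thesis
    using assms
    by (simp add: grounded_resistance_def right_diff_distrib sum_subtractf indicator_def)
qed

lemma grounded_resistance_insert:
  assumes "finite F" "p \<notin> F" "insert p F \<subseteq> V"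
  shows "\<exists>e. \<forall>x y. grounded_resistance (insert p F) x y = grounded_resistance F x y + (e x - e y)\<^sup>2"
proof -
  obtain e where "\<And>x y. green (insert p F) x y = green F x y + e x * e y"
    using green_insert[OF assms] by blast
  then have "grounded_resistance (insert p F) x y = grounded_resistance F x y + (e x - e y)\<^sup>2" for x y
    by (simp add: grounded_resistance_def dipole_def power2_eq_square algebra_simps)
  then show ?thesis by blast
qed

lemma grounded_resistance_mono:
  assumes "finite F" "F' \<subseteq> F" "F \<subseteq> V"
  shows "grounded_resistance F' x y \<le> grounded_resistance F x y"
  using assms
proof (induction "F - F'" arbitrary: F rule: infinite_finite_induct)
  case empty
  then have "F = F'" by auto
  then show ?case by simp
next
  case (insert p D)
  have F: "F = insert p (F - {p})" using insert(4) by auto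
  have "D = F - {p} - F'" "F' \<subseteq> F - {p}" using insert(2,4,6) by auto
  then have "grounded_resistance F' x y \<le> grounded_resistance (F - {p}) x y"
    using insert(5,7) by (intro insert(3)) auto
  also have "\<dots> \<le> grounded_resistance (insert p (F - {p})) x y"
    using grounded_resistance_insert[of "F - {p}" p] insert F
    by (metis Diff_iff finite_Diff insertI1 le_add_same_cancel1 zero_le_power2)
  finally show ?case using F by simp
qed auto

lemma grounded_resistance_empty [simp]: "grounded_resistance {} x y = 0"
  using dipole_outside[of "{}"] by (simp add: grounded_resistance_def)

text \<open>The family \<open>e\<close> is the Gram-Schmidt orthonormalisation of the indicators of the \<open>p k\<close>. It
  depends on their order, which is why they are given as a sequence.\<close>

lemma grounded_resistance_sum_squares:
  fixes p :: "nat \<Rightarrow> 'a"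
  assumes p: "inj p" "range p \<subseteq> V"
  shows "\<exists>e. \<forall>n x y. grounded_resistance (p ` {..<n}) x y = (\<Sum>k<n. (e k x - e k y)\<^sup>2)"
proof -
  have "\<exists>e. \<forall>x y. grounded_resistance (p ` {..<Suc n}) x y
      = grounded_resistance (p ` {..<n}) x y + (e x - e y)\<^sup>2" for n
  proof -
    have "p n \<notin> p ` {..<n}" using p(1) by (auto simp: inj_def)
    moreover have "insert (p n) (p ` {..<n}) \<subseteq> V" using p(2) by blast
    ultimately show ?thesis
      using grounded_resistance_insert[of "p ` {..<n}" "p n"] by (simp add: lessThan_Suc)
  qed
  then obtain e where e: "\<And>n x y. grounded_resistance (p ` {..<Suc n}) x y
      = grounded_resistance (p ` {..<n}) x y + (e n x - e n y)\<^sup>2"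
    by metis
  have "grounded_resistance (p ` {..<n}) x y = (\<Sum>k<n. (e k x - e k y)\<^sup>2)" for n x y
    by (induction n) (simp_all add: e del: image_Suc_lessThan)
  then show ?thesis by blast
qed

end

section \<open>Exhaustions by finite connected subnetworks\<close>

lemma connected_network_mono_path:
  assumes "connected_network F c" "F \<subseteq> F'" "x \<in> F" "y \<in> F"
  shows "(x, y) \<in> {(u, v). u \<in> F' \<and> v \<in> neighbours F' c u}\<^sup>*"
proof -
  have "{(u, v). u \<in> F \<and> v \<in> neighbours F c u} \<subseteq> {(u, v). u \<in> F' \<and> v \<in> neighbours F' c u}"
    using assms(2) by (auto simp: neighbours_def)
  then show ?thesis
    using assms rtrancl_mono unfolding connected_network_def by blast
qed

lemma connected_network_Un:
  assumes "connected_network F c" "connected_network F' c" "z \<in> F" "z \<in> F'"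
  shows "connected_network (F \<union> F') c"
  unfolding connected_network_def
proof (intro ballI)
  fix x y assume "x \<in> F \<union> F'" "y \<in> F \<union> F'"
  then have "(x, z) \<in> {(u, v). u \<in> F \<union> F' \<and> v \<in> neighbours (F \<union> F') c u}\<^sup>*"
    "(z, y) \<in> {(u, v). u \<in> F \<union> F' \<and> v \<in> neighbours (F \<union> F') c u}\<^sup>*"
    using connected_network_mono_path[OF assms(1), of "F \<union> F'"]
      connected_network_mono_path[OF assms(2), of "F \<union> F'"] assms(3,4) by auto
  then show "(x, y) \<in> {(u, v). u \<in> F \<union> F' \<and> v \<in> neighbours (F \<union> F') c u}\<^sup>*"
    by (rule rtrancl_trans)
qed

lemma finite_subset_incseq:
  assumes "incseq F" "finite T" "T \<subseteq> (\<Union>k. F k)"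
  shows "\<exists>K. \<forall>k\<ge>K. T \<subseteq> F k"
  using assms(2,3)
proof (induction T rule: finite_induct)
  case (insert t T)
  then obtain K k' where "\<And>k. k \<ge> K \<Longrightarrow> T \<subseteq> F k" "t \<in> F k'" by auto
  then have "\<forall>k\<ge>max K k'. insert t T \<subseteq> F k"
    using assms(1) by (auto dest: incseqD)
  then show ?case by blast
qed auto

context resistance_network
begin

text \<open>Only countably many terms of a summable family are nonzero, so every vertex has countably many
  neighbours, and all vertices are reachable from a single one by finite paths.\<close>

lemma countable_vertices: "countable V"
proof (cases "V = {}")
  case False
  then obtain z where z: "z \<in> V" by blast
  let ?E = "{(u, v). u \<in> V \<and> v \<in> neighbours V c u}"
  have "countable (neighbours V c x)" if "x \<in> V" for x
  proof -
    have "{y \<in> neighbours V c x. c x y \<noteq> 0} = neighbours V c x"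
      by (auto simp: neighbours_def)
    then show ?thesis
      using summable_countable_real[OF total_conductance_finite[OF that]] by simp
  qed
  moreover have "?E `` {x} = (if x \<in> V then neighbours V c x else {})" for x by auto
  ultimately have "countable (?E `` {x})" for x by simp
  then have "countable (?E `` Y)" if "countable Y" for Y
    using that by (rule countable_Image)
  then have "countable (?E\<^sup>* `` {z})"
    by (rule countable_rtrancl) auto
  moreover have "V \<subseteq> ?E\<^sup>* `` {z}"
    using connected z by (auto simp: connected_network_def)
  ultimately show ?thesis by (rule countable_subset[rotated])
qed simp

lemma finite_connected_subnetwork:
  assumes "x \<in> V" "y \<in> V"
  shows "\<exists>P. finite P \<and> P \<subseteq> V \<and> x \<in> P \<and> y \<in> P \<and> connected_network P c"
proof -
  have "(x, y) \<in> {(u, v). u \<in> V \<and> v \<in> neighbours V c u}\<^sup>*"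
    using connected assms by (simp add: connected_network_def)
  then show ?thesis
  proof (induction rule: rtrancl_induct)
    case base
    show ?case using assms by (intro exI[of _ "{x}"]) (auto simp: connected_network_def)
  next
    case (step y z)
    then obtain P where P: "finite P" "P \<subseteq> V" "x \<in> P" "y \<in> P" "connected_network P c" by blast
    have yz: "y \<in> V" "z \<in> V" "c y z > 0" using step(2) by (auto simp: neighbours_def)
    then have zy: "c z y > 0" using conductance_sym[of y z] by simp
    have "connected_network {y, z} c"
      unfolding connected_network_def
    proof (intro ballI)
      fix a b assume "a \<in> {y, z}" "b \<in> {y, z}"
      then have "a = b \<or> (a, b) \<in> {(u, v). u \<in> {y, z} \<and> v \<in> neighbours {y, z} c u}"
        using yz zy by (auto simp: neighbours_def)
      then show "(a, b) \<in> {(u, v). u \<in> {y, z} \<and> v \<in> neighbours {y, z} c u}\<^sup>*"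
        by blast
    qed
    from connected_network_Un[OF P(5) this P(4)] have "connected_network (P \<union> {y, z}) c" by simp
    then show ?case using P yz by (intro exI[of _ "P \<union> {y, z}"]) auto
  qed
qed

text \<open>Vertices of infinite degree have infinite balls around them. Finite connected sets are obtained
  instead as unions of paths from \<open>x\<close> to the first vertices of an enumeration. The existence of
  an exhaustion is what makes the limit in the definition of the wired resistance unique.\<close>

lemma exhaustion_exists:
  assumes "x \<in> V" "y \<in> V"
  shows "\<exists>F. exhaustion V c F \<and> (\<forall>k. x \<in> F k \<and> y \<in> F k)"
proof -
  obtain p where p: "V = range (p :: nat \<Rightarrow> 'a)"
    using countable_vertices assms(1) uncountable_def by blast
  have "\<exists>P. finite P \<and> P \<subseteq> V \<and> x \<in> P \<and> p n \<in> P \<and> connected_network P c" for n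
    using p by (intro finite_connected_subnetwork assms(1)) simp
  then obtain P where P: "\<And>n. finite (P n)" "\<And>n. P n \<subseteq> V" "\<And>n. x \<in> P n" "\<And>n. p n \<in> P n"
    "\<And>n. connected_network (P n) c"
    by metis
  obtain Q where Q: "finite Q" "Q \<subseteq> V" "x \<in> Q" "y \<in> Q" "connected_network Q c"
    using finite_connected_subnetwork[OF assms] by blast
  define F where "F k = Q \<union> (\<Union>n<k. P n)" for k
  have xF: "x \<in> F k" for k using Q by (simp add: F_def)
  have "connected_network (F k) c" for k
  proof (induction k)
    case 0
    then show ?case using Q by (simp add: F_def)
  next
    case (Suc k)
    have "F (Suc k) = F k \<union> P k" by (auto simp: F_def lessThan_Suc)
    then show ?case using connected_network_Un[OF Suc P(5) xF P(3)] by simp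
  qed
  moreover have "incseq F" by (intro monoI) (auto simp: F_def)
  moreover have "finite (F k)" for k using Q P by (simp add: F_def)
  moreover have "(\<Union>k. F k) = V"
  proof
    show "(\<Union>k. F k) \<subseteq> V" using Q P(2) by (auto simp: F_def)
    show "V \<subseteq> (\<Union>k. F k)"
    proof
      fix v assume "v \<in> V"
      then obtain n where "v = p n" using p by blast
      then have "v \<in> F (Suc n)" using P(4) by (auto simp: F_def)
      then show "v \<in> (\<Union>k. F k)" by blast
    qed
  qed
  ultimately have "exhaustion V c F" by (simp add: exhaustion_def)
  then show ?thesis using xF Q(4) by (auto simp: F_def)
qed

end

section \<open>Energy and wired networks\<close>

lemma laplacian_finite:
  assumes "finite W" "\<And>y. y \<in> W \<Longrightarrow> 0 \<le> k x y"
  shows "laplacian W k v x = (\<Sum>y\<in>W. k x y * (v x - v y))"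
proof -
  have "finite (neighbours W k x)" using assms by (simp add: neighbours_def)
  then have "laplacian W k v x = (\<Sum>y\<in>neighbours W k x. k x y * (v x - v y))"
    by (simp add: laplacian_def)
  also have "\<dots> = (\<Sum>y\<in>W. k x y * (v x - v y))"
    by (rule sum.mono_neutral_left) (use assms in \<open>force simp: neighbours_def\<close>)+
  finally show ?thesis .
qed

context resistance_network
begin

definition total_conductance :: "'a \<Rightarrow> real" where
  "total_conductance x = (\<Sum>\<^sub>\<infinity>y\<in>neighbours V c x. c x y)"

text \<open>The conductance from \<open>x\<close> to the vertex at infinity of the wired network of \<open>F\<close>.\<close>

definition escape_conductance :: "'a set \<Rightarrow> 'a \<Rightarrow> real" where
  "escape_conductance F x = (\<Sum>\<^sub>\<infinity>y\<in>neighbours V c x - F. c x y)"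

text \<open>The matrix of the Laplacian of the whole network. On functions supported on \<open>F\<close> it
  acts as the Laplacian of the wired network of \<open>F\<close> with the vertex at infinity grounded.\<close>

definition dirichlet_matrix :: "'a \<Rightarrow> 'a \<Rightarrow> real" where
  "dirichlet_matrix x y = (if x = y then total_conductance x else 0) - c x y"

lemma escape_conductance_nonneg: "x \<in> V \<Longrightarrow> 0 \<le> escape_conductance F x"
  unfolding escape_conductance_def
  by (rule infsum_nonneg) (auto simp: neighbours_def)

lemma total_conductance_split:
  assumes "finite F" "F \<subseteq> V" "x \<in> V"
  shows "total_conductance x = (\<Sum>y\<in>F. c x y) + escape_conductance F x"
proof -
  let ?N = "neighbours V c x"
  have "total_conductance x = (\<Sum>\<^sub>\<infinity>y\<in>(?N \<inter> F) \<union> (?N - F). c x y)"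
    by (simp add: total_conductance_def Un_Diff_Int Un_commute)
  also have "\<dots> = (\<Sum>\<^sub>\<infinity>y\<in>?N \<inter> F. c x y) + escape_conductance F x"
    unfolding escape_conductance_def
    by (rule infsum_Un_disjoint)
       (use total_conductance_finite[OF assms(3)] in \<open>auto intro: summable_on_subset_banach\<close>)
  also have "(\<Sum>\<^sub>\<infinity>y\<in>?N \<inter> F. c x y) = (\<Sum>y\<in>F. c x y)"
  proof -
    have "(\<Sum>y\<in>?N \<inter> F. c x y) = (\<Sum>y\<in>F. c x y)"
      using assms conductance_nonneg[OF assms(3)]
      by (intro sum.mono_neutral_left) (auto simp: neighbours_def less_le)
    then show ?thesis using assms by simp
  qed
  finally show ?thesis .
qed

lemma dirichlet_matrix_row:
  assumes "finite F" "F \<subseteq> V" "x \<in> F"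
  shows "(\<Sum>y\<in>F. dirichlet_matrix x y * u y)
    = (\<Sum>y\<in>F. c x y * (u x - u y)) + escape_conductance F x * u x"
proof -
  have "(\<Sum>y\<in>F. dirichlet_matrix x y * u y)
      = (\<Sum>y\<in>F. (if x = y then total_conductance x * u y else 0)) - (\<Sum>y\<in>F. c x y * u y)"
    unfolding sum_subtractf[symmetric]
    by (intro sum.cong) (auto simp: dirichlet_matrix_def left_diff_distrib)
  also have "\<dots> = total_conductance x * u x - (\<Sum>y\<in>F. c x y * u y)"
    using assms by simp
  also have "\<dots> = ((\<Sum>y\<in>F. c x y * u x) - (\<Sum>y\<in>F. c x y * u y)) + escape_conductance F x * u x"
    using assms by (subst total_conductance_split[of F])
      (auto simp: distrib_right sum_distrib_right)
  finally show ?thesis by (simp add: right_diff_distrib sum_subtractf)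
qed

text \<open>Summation by parts: each edge is counted in both directions, with opposite flows.\<close>

lemma sum_flow_symmetric:
  assumes "F \<subseteq> V"
  shows "(\<Sum>x\<in>F. \<Sum>y\<in>F. c x y * (u x - u y) * f x)
    = (\<Sum>x\<in>F. \<Sum>y\<in>F. c x y * (u x - u y) * (f x - f y)) / 2"
proof -
  let ?D = "\<Sum>x\<in>F. \<Sum>y\<in>F. c x y * (u x - u y) * f x"
  have "?D = (\<Sum>x\<in>F. \<Sum>y\<in>F. c y x * (u y - u x) * f y)"
    by (rule sum.swap)
  also have "\<dots> = (\<Sum>x\<in>F. \<Sum>y\<in>F. - (c x y * (u x - u y) * f y))"
  proof (intro sum.cong refl)
    fix x y assume "x \<in> F" "y \<in> F"
    then have "c y x = c x y" using assms conductance_sym by blast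
    then show "c y x * (u y - u x) * f y = - (c x y * (u x - u y) * f y)"
      by (simp add: algebra_simps)
  qed
  finally have "?D + ?D = ?D + (\<Sum>x\<in>F. \<Sum>y\<in>F. - (c x y * (u x - u y) * f y))" by simp
  also have "\<dots> = (\<Sum>x\<in>F. \<Sum>y\<in>F. c x y * (u x - u y) * (f x - f y))"
    by (simp add: right_diff_distrib sum_subtractf sum_negf)
  finally show ?thesis by simp
qed

lemma quadratic_form_dirichlet_matrix:
  assumes "finite F" "F \<subseteq> V"
  shows "quadratic_form dirichlet_matrix F u
    = (\<Sum>x\<in>F. \<Sum>y\<in>F. c x y * (u x - u y)\<^sup>2) / 2 + (\<Sum>x\<in>F. escape_conductance F x * (u x)\<^sup>2)"
proof -
  have "quadratic_form dirichlet_matrix F u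
      = (\<Sum>x\<in>F. (\<Sum>y\<in>F. c x y * (u x - u y) * u x) + escape_conductance F x * (u x)\<^sup>2)"
    unfolding quadratic_form_def
  proof (intro sum.cong refl)
    fix x assume "x \<in> F"
    show "u x * (\<Sum>y\<in>F. dirichlet_matrix x y * u y)
        = (\<Sum>y\<in>F. c x y * (u x - u y) * u x) + escape_conductance F x * (u x)\<^sup>2"
      unfolding dirichlet_matrix_row[OF assms \<open>x \<in> F\<close>] sum_distrib_right[symmetric]
      by (simp add: algebra_simps power2_eq_square)
  qed
  also have "\<dots> = (\<Sum>x\<in>F. \<Sum>y\<in>F. c x y * (u x - u y) * u x)
      + (\<Sum>x\<in>F. escape_conductance F x * (u x)\<^sup>2)"
    by (rule sum.distrib)
  finally show ?thesis
    using sum_flow_symmetric[OF assms(2), of u u] by (simp add: power2_eq_square mult.assoc)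
qed

lemma quadratic_form_nonneg:
  assumes "finite F" "F \<subseteq> V"
  shows "0 \<le> quadratic_form dirichlet_matrix F u"
  unfolding quadratic_form_dirichlet_matrix[OF assms]
  using assms(2)
  by (intro add_nonneg_nonneg divide_nonneg_nonneg sum_nonneg mult_nonneg_nonneg
      conductance_nonneg escape_conductance_nonneg) auto

text \<open>The energy is a sum of nonnegative contributions of edges. An end of the edge may lie outside
  \<open>F\<close>; enlarging \<open>F\<close> by it does not change the energy.\<close>

lemma edge_bound:
  assumes "finite F" "F \<subseteq> V" "\<And>z. z \<notin> F \<Longrightarrow> u z = 0" "x \<in> V" "y \<in> V"
  shows "c x y * (u x - u y)\<^sup>2 \<le> quadratic_form dirichlet_matrix F u"
proof (cases "x = y")
  case True
  then show ?thesis using quadratic_form_nonneg[OF assms(1,2)] by simp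
next
  case False
  define F' where "F' = insert x (insert y F)"
  have F': "finite F'" "F' \<subseteq> V" using assms by (auto simp: F'_def)
  let ?f = "\<lambda>(a, b). c a b * (u a - u b)\<^sup>2"
  have "2 * (c x y * (u x - u y)\<^sup>2) = sum ?f {(x, y), (y, x)}"
    using False assms(4,5) by (simp add: conductance_sym[of y x] power2_commute[of "u y"])
  also have "\<dots> \<le> sum ?f (F' \<times> F')"
    using F' by (intro sum_mono2) (auto simp: F'_def intro!: mult_nonneg_nonneg conductance_nonneg)
  also have "\<dots> = (\<Sum>a\<in>F'. \<Sum>b\<in>F'. c a b * (u a - u b)\<^sup>2)"
    by (simp add: sum.cartesian_product)
  finally have "c x y * (u x - u y)\<^sup>2 \<le> (\<Sum>a\<in>F'. \<Sum>b\<in>F'. c a b * (u a - u b)\<^sup>2) / 2"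
    by simp
  also have "\<dots> \<le> quadratic_form dirichlet_matrix F' u"
    unfolding quadratic_form_dirichlet_matrix[OF F'] using F'
    by (auto intro!: sum_nonneg mult_nonneg_nonneg escape_conductance_nonneg)
  also have "\<dots> = quadratic_form dirichlet_matrix F u"
    using F' assms(3) by (intro quadratic_form_mono_neutral) (auto simp: F'_def)
  finally show ?thesis .
qed

text \<open>Evaluation differences are bounded functionals for the energy, with a bound that is uniform in the
  support. This is used with \<open>y\<close> outside the support to show positive definiteness, and on dipoles to
  bound resistances.\<close>

lemma path_bound:
  assumes "x \<in> V" "y \<in> V"
  shows "\<exists>C. \<forall>F u. finite F \<longrightarrow> F \<subseteq> V \<longrightarrow> (\<forall>z. z \<notin> F \<longrightarrow> u z = 0) \<longrightarrow>
    (u x - u y)\<^sup>2 \<le> C * quadratic_form dirichlet_matrix F u"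
proof -
  have "(x, y) \<in> {(u, v). u \<in> V \<and> v \<in> neighbours V c u}\<^sup>*"
    using connected assms by (simp add: connected_network_def)
  then show ?thesis
  proof (induction rule: rtrancl_induct)
    case base
    show ?case by (rule exI[of _ 0]) simp
  next
    case (step y z)
    then obtain C where C: "\<And>F u. finite F \<Longrightarrow> F \<subseteq> V \<Longrightarrow> (\<forall>z. z \<notin> F \<longrightarrow> u z = 0) \<Longrightarrow>
        (u x - u y)\<^sup>2 \<le> C * quadratic_form dirichlet_matrix F u"
      by blast
    have yz: "y \<in> V" "z \<in> V" "c y z > 0" using step(2) by (auto simp: neighbours_def)
    have "(u x - u z)\<^sup>2 \<le> (2 * C + 2 / c y z) * quadratic_form dirichlet_matrix F u"
      if F: "finite F" "F \<subseteq> V" "\<forall>z. z \<notin> F \<longrightarrow> u z = 0" for F u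
    proof -
      let ?q = "quadratic_form dirichlet_matrix F u"
      have "c y z * (u y - u z)\<^sup>2 \<le> ?q"
        using F yz by (intro edge_bound) auto
      then have "(u y - u z)\<^sup>2 \<le> ?q / c y z"
        using yz(3) by (simp add: pos_le_divide_eq mult.commute)
      moreover have "(u x - u y)\<^sup>2 \<le> C * ?q" using C[OF F] .
      moreover have "(u x - u z)\<^sup>2 \<le> 2 * (u x - u y)\<^sup>2 + 2 * (u y - u z)\<^sup>2"
      proof -
        have "0 \<le> ((u x - u y) - (u y - u z))\<^sup>2" by simp
        then show ?thesis by (simp add: power2_eq_square algebra_simps)
      qed
      ultimately show ?thesis by (simp add: distrib_right)
    qed
    then show ?case by blast
  qed
qed

lemma laplacian_wired_Some:
  assumes F: "finite F" "F \<subseteq> V" and z: "z \<in> F"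
  shows "laplacian (wired_vertices F) (wired_conductance V c F) v (Some z)
    = (\<Sum>y\<in>F. dirichlet_matrix z y * (v (Some y) - v None))"
proof -
  have "laplacian (wired_vertices F) (wired_conductance V c F) v (Some z)
      = (\<Sum>y\<in>wired_vertices F. wired_conductance V c F (Some z) y * (v (Some z) - v y))"
  proof (rule laplacian_finite)
    fix y assume "y \<in> wired_vertices F"
    moreover have "z \<in> V" using F z by blast
    ultimately show "0 \<le> wired_conductance V c F (Some z) y"
      using F escape_conductance_nonneg[of z F] conductance_nonneg[of z]
      by (auto simp: wired_vertices_def escape_conductance_def)
  qed (use F in \<open>simp add: wired_vertices_def\<close>)
  also have "\<dots> = escape_conductance F z * (v (Some z) - v None)
      + (\<Sum>y\<in>F. c z y * (v (Some z) - v (Some y)))"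
    using F by (simp add: wired_vertices_def escape_conductance_def sum.reindex)
  also have "\<dots> = (\<Sum>y\<in>F. dirichlet_matrix z y * (v (Some y) - v None))"
    by (subst dirichlet_matrix_row[OF F z]) simp
  finally show ?thesis .
qed

text \<open>No charge is lost: the Laplacian at infinity is determined by its values on \<open>F\<close>. So a potential
  that solves the equations on \<open>F\<close> for a source and a sink in \<open>F\<close> also solves the one at infinity.\<close>

lemma laplacian_wired_None:
  assumes F: "finite F" "F \<subseteq> V"
  shows "laplacian (wired_vertices F) (wired_conductance V c F) v None
    = - (\<Sum>z\<in>F. \<Sum>y\<in>F. dirichlet_matrix z y * (v (Some y) - v None))"
proof -
  have "laplacian (wired_vertices F) (wired_conductance V c F) v None
      = (\<Sum>y\<in>wired_vertices F. wired_conductance V c F None y * (v None - v y))"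
  proof (rule laplacian_finite)
    fix y assume "y \<in> wired_vertices F"
    then show "0 \<le> wired_conductance V c F None y"
      using F escape_conductance_nonneg[of _ F]
      by (auto simp: wired_vertices_def escape_conductance_def)
  qed (use F in \<open>simp add: wired_vertices_def\<close>)
  also have "\<dots> = (\<Sum>z\<in>F. escape_conductance F z * (v None - v (Some z)))"
    using F by (simp add: wired_vertices_def escape_conductance_def sum.reindex)
  also have "\<dots> = - (\<Sum>z\<in>F. escape_conductance F z * (v (Some z) - v None))"
    by (simp add: sum_negf[symmetric] algebra_simps)
  also have "\<dots> = - (\<Sum>z\<in>F. (\<Sum>y\<in>F. c z y * (v (Some z) - v (Some y)))
      + escape_conductance F z * (v (Some z) - v None))"
    using sum_flow_symmetric[OF F(2), of "\<lambda>z. v (Some z)" "\<lambda>z. 1"] by (simp add: sum.distrib)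
  also have "\<dots> = - (\<Sum>z\<in>F. \<Sum>y\<in>F. dirichlet_matrix z y * (v (Some y) - v None))"
    by (simp add: dirichlet_matrix_row[OF F])
  finally show ?thesis .
qed

end

section \<open>Convergence of the wired resistances and the embedding\<close>

text \<open>On a finite network the constants are finitely supported functions of energy 0, so it is positive
  definiteness of the energy that rests on the infinite vertex set.\<close>

locale infinite_resistance_network = resistance_network +
  assumes infinite_vertices: "infinite V"
begin

sublocale positive_definite V dirichlet_matrix
proof
  fix x y assume "x \<in> V" "y \<in> V"
  then show "dirichlet_matrix x y = dirichlet_matrix y x"
    using conductance_sym by (simp add: dirichlet_matrix_def)
next
  fix F u x assume F: "finite F" "F \<subseteq> V" "x \<in> F" and ux: "u x \<noteq> (0::real)"
  \<comment> \<open>The values of \<open>u\<close> outside \<open>F\<close> are arbitrary, while the path bound needs them to be 0.\<close>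
  let ?u = "\<lambda>z. if z \<in> F then u z else 0"
  obtain y where y: "y \<in> V" "y \<notin> F"
    using infinite_vertices finite_subset[OF _ F(1), of V] by auto
  have "x \<in> V" using F by blast
  from path_bound[OF this y(1)] obtain C where
    C: "\<forall>F u. finite F \<longrightarrow> F \<subseteq> V \<longrightarrow> (\<forall>z. z \<notin> F \<longrightarrow> u z = 0) \<longrightarrow>
      (u x - u y)\<^sup>2 \<le> C * quadratic_form dirichlet_matrix F u"
    by (elim exE)
  have "(?u x - ?u y)\<^sup>2 \<le> C * quadratic_form dirichlet_matrix F ?u"
    using F(1,2) by (intro C[rule_format]) auto
  moreover have "quadratic_form dirichlet_matrix F ?u = quadratic_form dirichlet_matrix F u"
    by (rule quadratic_form_cong) simp
  ultimately have "(u x)\<^sup>2 \<le> C * quadratic_form dirichlet_matrix F u" using F y by simp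
  moreover have "(u x)\<^sup>2 > 0" using ux by simp
  ultimately have "quadratic_form dirichlet_matrix F u \<noteq> 0" by auto
  then show "0 < quadratic_form dirichlet_matrix F u"
    using quadratic_form_nonneg[OF F(1,2), of u] by simp
qed

text \<open>Potentials on the wired network are determined up to a constant; subtracting the value at infinity
  leaves the dipole potential.\<close>

lemma effective_resistance_wired:
  assumes F: "finite F" "F \<subseteq> V" "x \<in> F" "y \<in> F"
  shows "effective_resistance (wired_vertices F) (wired_conductance V c F) (Some x) (Some y)
    = grounded_resistance F x y"
  unfolding effective_resistance_def
proof (rule the_equality)
  let ?v = "case_option 0 (dipole F x y)"
  have "laplacian (wired_vertices F) (wired_conductance V c F) ?v z
      = indicator {Some x} z - indicator {Some y} z" if "z \<in> wired_vertices F" for z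
  proof (cases z)
    case None
    have "(\<Sum>z\<in>F. indicator {x} z - indicator {y} z :: real) = 0"
      using F by (simp add: sum_subtractf indicator_def)
    then show ?thesis
      using None F by (simp add: laplacian_wired_None dipole_equation)
  next
    case (Some z')
    then have "z' \<in> F" using that by (auto simp: wired_vertices_def)
    then show ?thesis
      using Some F by (simp add: laplacian_wired_Some dipole_equation indicator_def)
  qed
  then show "\<exists>v. (\<forall>z\<in>wired_vertices F. laplacian (wired_vertices F) (wired_conductance V c F) v z
      = indicator {Some x} z - indicator {Some y} z)
      \<and> grounded_resistance F x y = v (Some x) - v (Some y)"
    by (intro exI[of _ ?v]) (simp add: grounded_resistance_def)
next
  fix r
  assume "\<exists>v. (\<forall>z\<in>wired_vertices F. laplacian (wired_vertices F) (wired_conductance V c F) v z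
      = indicator {Some x} z - indicator {Some y} z) \<and> r = v (Some x) - v (Some y)"
  then obtain v where v: "\<And>z. z \<in> wired_vertices F \<Longrightarrow>
      laplacian (wired_vertices F) (wired_conductance V c F) v z
      = indicator {Some x} z - indicator {Some y} z" and r: "r = v (Some x) - v (Some y)"
    by blast
  have "v (Some z) - v None = dipole F x y z" if "z \<in> F" for z
  proof (rule dipole_unique[OF F that, where u = "\<lambda>z. v (Some z) - v None"])
    fix z assume z: "z \<in> F"
    then have "Some z \<in> wired_vertices F" by (simp add: wired_vertices_def)
    from v[OF this] show "(\<Sum>w\<in>F. dirichlet_matrix z w * (v (Some w) - v None))
        = indicator {x} z - indicator {y} z"
      using laplacian_wired_Some[OF F(1,2) z, of v] by (simp add: indicator_def)
  qed
  from this[OF F(3)] this[OF F(4)] show "r = grounded_resistance F x y"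
    by (simp add: r grounded_resistance_def)
qed

text \<open>The resistance \<open>R\<close> is both the potential difference and the energy of the dipole, so the path bound
  reads \<open>R\<^sup>2 \<le> C * R\<close>.\<close>

lemma grounded_resistance_bounded:
  assumes "x \<in> V" "y \<in> V"
  shows "\<exists>C. \<forall>F. finite F \<longrightarrow> F \<subseteq> V \<longrightarrow> grounded_resistance F x y \<le> C"
proof -
  obtain C where C: "\<And>F u. finite F \<Longrightarrow> F \<subseteq> V \<Longrightarrow> (\<forall>z. z \<notin> F \<longrightarrow> u z = 0) \<Longrightarrow>
      (u x - u y)\<^sup>2 \<le> C * quadratic_form dirichlet_matrix F u"
    using path_bound[OF assms] by blast
  have "grounded_resistance F x y \<le> max 0 C" if F: "finite F" "F \<subseteq> V" for F
  proof -
    define F' where "F' = insert x (insert y F)"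
    have F': "finite F'" "F' \<subseteq> V" "x \<in> F'" "y \<in> F'" using F assms by (auto simp: F'_def)
    let ?R = "grounded_resistance F' x y"
    have "?R\<^sup>2 \<le> C * ?R"
      using C[OF F'(1,2), of "dipole F' x y"] dipole_outside[OF F'(1,2)]
      by (simp add: quadratic_form_dipole[OF F'] grounded_resistance_def)
    then have "?R \<le> max 0 C"
      by (cases "?R > 0") (auto simp: power2_eq_square)
    moreover have "grounded_resistance F x y \<le> ?R"
      using F' by (intro grounded_resistance_mono) (auto simp: F'_def)
    ultimately show ?thesis by simp
  qed
  then show ?thesis by blast
qed

text \<open>By monotonicity, an exhaustion and the initial segments of the enumeration interleave: every finite
  set of one sequence lies in some set of the other, so both give the same limit of resistances. The
  initial segments may be disconnected, as Green kernels are defined for all finite sets.\<close>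

lemma wired_resistance_sums:
  fixes p :: "nat \<Rightarrow> 'a"
  assumes p: "bij_betw p UNIV V"
    and e: "\<And>n x y. grounded_resistance (p ` {..<n}) x y = (\<Sum>k<n. (e k x - e k y)\<^sup>2)"
    and xy: "x \<in> V" "y \<in> V"
  shows "(\<lambda>k. (e k x - e k y)\<^sup>2) sums wired_resistance V c x y"
proof -
  have range_p: "range p = V" using p by (simp add: bij_betw_def)
  define S where "S = (\<Sum>k. (e k x - e k y)\<^sup>2)"
  obtain C where C: "\<And>F. finite F \<Longrightarrow> F \<subseteq> V \<Longrightarrow> grounded_resistance F x y \<le> C"
    using grounded_resistance_bounded[OF xy] by blast
  have pn: "finite (p ` {..<n})" "p ` {..<n} \<subseteq> V" for n using range_p by auto
  have summable: "summable (\<lambda>k. (e k x - e k y)\<^sup>2)"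
    by (rule summableI_nonneg_bounded[of _ C]) (use C[OF pn] e in auto)
  then have S: "(\<lambda>k. (e k x - e k y)\<^sup>2) sums S" by (simp add: S_def summable_sums)
  then have lim: "(\<lambda>n. grounded_resistance (p ` {..<n}) x y) \<longlonglongrightarrow> S"
    by (simp add: sums_def e)
  have le_S: "grounded_resistance (p ` {..<n}) x y \<le> S" for n
    unfolding S_def e using summable by (intro sum_le_suminf) auto
  have conv: "(\<lambda>k. effective_resistance (wired_vertices (F k)) (wired_conductance V c (F k))
      (Some x) (Some y)) \<longlonglongrightarrow> S"
    if F: "exhaustion V c F" "\<forall>k. x \<in> F k \<and> y \<in> F k" for F
  proof -
    have Fk: "finite (F k)" "F k \<subseteq> V" for k using F(1) by (auto simp: exhaustion_def)
    have "(\<lambda>k. grounded_resistance (F k) x y) \<longlonglongrightarrow> S"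
    proof (rule order_tendstoI)
      fix a assume "a < S"
      from order_tendstoD(1)[OF lim this] obtain n where "a < grounded_resistance (p ` {..<n}) x y"
        by (auto simp: eventually_sequentially)
      moreover obtain K where "\<And>k. k \<ge> K \<Longrightarrow> p ` {..<n} \<subseteq> F k"
        using finite_subset_incseq[of F "p ` {..<n}"] F(1) pn by (auto simp: exhaustion_def)
      ultimately show "\<forall>\<^sub>F k in sequentially. a < grounded_resistance (F k) x y"
        unfolding eventually_sequentially
        using grounded_resistance_mono Fk by (meson order.strict_trans2)
    next
      fix a assume a: "S < a"
      have "grounded_resistance (F k) x y \<le> S" for k
      proof -
        have "incseq (\<lambda>n. p ` {..<n})" by (intro monoI image_mono) auto
        moreover have "(\<Union>n. p ` {..<n}) = V" using range_p by auto
        ultimately obtain n where "F k \<subseteq> p ` {..<n}"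
          using finite_subset_incseq[of "\<lambda>n. p ` {..<n}" "F k"] Fk by auto
        then show ?thesis
          using grounded_resistance_mono[OF pn(1) _ pn(2)] le_S order_trans by blast
      qed
      then show "\<forall>\<^sub>F k in sequentially. grounded_resistance (F k) x y < a"
        using a by (auto intro: always_eventually order.strict_trans1)
    qed
    then show ?thesis using F(2) Fk by (simp add: effective_resistance_wired)
  qed
  have "wired_resistance V c x y = S"
    unfolding wired_resistance_def
  proof (rule the_equality)
    show "\<forall>F. exhaustion V c F \<and> (\<forall>k. x \<in> F k \<and> y \<in> F k) \<longrightarrow>
        (\<lambda>k. effective_resistance (wired_vertices (F k)) (wired_conductance V c (F k))
          (Some x) (Some y)) \<longlonglongrightarrow> S"
      using conv by blast
  next
    fix r assume "\<forall>F. exhaustion V c F \<and> (\<forall>k. x \<in> F k \<and> y \<in> F k) \<longrightarrow>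
        (\<lambda>k. effective_resistance (wired_vertices (F k)) (wired_conductance V c (F k))
          (Some x) (Some y)) \<longlonglongrightarrow> r"
    then show "r = S"
      using exhaustion_exists[OF xy] conv LIMSEQ_unique by blast
  qed
  then show ?thesis using S by simp
qed

text \<open>Only the differences \<open>e k x - e k y\<close> are known to be square summable: for a recurrent network the
  sum of \<open>(e k x)\<^sup>2\<close> diverges. Subtracting the values at a base point repairs this and does not change
  distances.\<close>

lemma wired_resistance_embedding:
  "\<exists>w. w \<in> V \<rightarrow> carrier (l2_space V) \<and>
    (\<forall>x\<in>V. \<forall>y\<in>V. sqrt (wired_resistance V c x y) = hnorm (l2_space V) (w x \<ominus>\<^bsub>l2_space V\<^esub> w y))"
proof -
  have "V \<noteq> {}" using infinite_vertices by auto
  then obtain base where base: "base \<in> V" by (auto simp only: ex_in_conv[symmetric])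
  define p where "p = from_nat_into V"
  have p: "bij_betw p UNIV V"
    unfolding p_def by (rule bij_betw_from_nat_into[OF countable_vertices infinite_vertices])
  then have "inj p" "range p \<subseteq> V" by (auto simp: bij_betw_def)
  from grounded_resistance_sum_squares[OF this] obtain e where
    e: "\<And>n x y. grounded_resistance (p ` {..<n}) x y = (\<Sum>k<n. (e k x - e k y)\<^sup>2)" by blast
  define w where "w x q = (if q \<in> V then e (inv_into UNIV p q) x - e (inv_into UNIV p q) base else 0)" for x q
  have sum_w: "((\<lambda>q. (w x q - w y q)\<^sup>2) has_sum wired_resistance V c x y) V"
    if "x \<in> V" "y \<in> V" for x y
  proof -
    have "((\<lambda>k. (e k x - e k y)\<^sup>2) has_sum wired_resistance V c x y) UNIV"
      by (rule sums_nonneg_imp_has_sum[OF wired_resistance_sums[OF p e that]]) simp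
    moreover have "e k x - e k y = w x (p k) - w y (p k)" for k
    proof -
      have "p k \<in> V" using \<open>range p \<subseteq> V\<close> by blast
      then show ?thesis by (simp add: w_def inv_f_f[OF \<open>inj p\<close>])
    qed
    ultimately show ?thesis
      using has_sum_reindex_bij_betw[OF p, of "\<lambda>q. (w x q - w y q)\<^sup>2"] by simp
  qed
  have w: "w x \<in> carrier (l2_space V)" if "x \<in> V" for x
  proof -
    have "w base q = 0" for q by (simp add: w_def)
    then have "(\<lambda>q. (w x q)\<^sup>2) summable_on V"
      using sum_w[OF that base] by (auto simp: summable_on_def)
    then show ?thesis by (simp add: mem_l2_space w_def)
  qed
  have "sqrt (wired_resistance V c x y) = hnorm (l2_space V) (w x \<ominus>\<^bsub>l2_space V\<^esub> w y)"
    if "x \<in> V" "y \<in> V" for x y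
    using infsumI[OF sum_w[OF that]] w that by (simp add: l2_space_minus hnorm_l2_space)
  with w show ?thesis by (intro exI[of _ w]) auto
qed

end

theorem corollary5p5:
  fixes V :: "'a set" and c :: "'a \<Rightarrow> 'a \<Rightarrow> real"
  assumes "resistance_network V c" and "infinite V"
  shows "\<exists>(H :: ('a \<Rightarrow> real) inner_product_space) (w :: 'a \<Rightarrow> 'a \<Rightarrow> real).
           real_hilbert_space H \<and> w \<in> V \<rightarrow> carrier H \<and>
           (\<forall>x\<in>V. \<forall>y\<in>V. sqrt (wired_resistance V c x y) = hnorm H (w x \<ominus>\<^bsub>H\<^esub> w y))"
proof -
  interpret infinite_resistance_network V c
    using assms by (intro infinite_resistance_network.intro infinite_resistance_network_axioms.intro)
  from wired_resistance_embedding obtain w where "w \<in> V \<rightarrow> carrier (l2_space V)"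
    "\<forall>x\<in>V. \<forall>y\<in>V. sqrt (wired_resistance V c x y) = hnorm (l2_space V) (w x \<ominus>\<^bsub>l2_space V\<^esub> w y)"
    by (elim exE conjE)
  then show ?thesis
    by (intro exI[of _ "l2_space V"] exI[of _ w] conjI real_hilbert_space_l2_space)
qed

end
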